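(* Let $m\le n$ and let $S=\{\mathbf{u}_1,\dots,\mathbf{u}_m\}\subseteq\mathbb{F}_2^n$ be a permutative set of $m$ distinct vectors. Then the disjunctive closure \[\langle S\rangle_\vee:=\{a_1\mathbf{u}_1\vee a_2\mathbf{u}_2\vee\cdots\vee a_m\mathbf{u}_m\mid a_i\in\mathbb{F}_2,\ 1\le i\le m\}\] is a powerful set of size $2^m$.
   Context: A set $S\subseteq\mathbb{F}_2^n$ is a powerful set if for every $X\subseteq[n]$ the number of vectors in $S$ that are zero in all positions of $X$ is a power of $2$. For $\mathbf{u}=(u_i),\mathbf{v}=(v_i)\in\mathbb{F}_2^n$, $\mathbf{u}\vee\mathbf{v}:=(\max\{u_i,v_i\})_{i=1}^n$; for $a\in\mathbb{F}_2$, $a\mathbf{u}=\mathbf{u}$ if $a=1$ and $a\mathbf{u}=\mathbf{0}$ if $a=0$. A set $S\subseteq\mathbb{F}_2^n$ is permutative if the $|S|\times n$ matrix whose rows are the elements of $S$ contains a $|S|\times|S|$ submatrix (obtained by choosing $|S|$ columns) that is a permutation matrix, i.e. has exactly one entry $1$ in each row and each column and $0$s elsewhere. *)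

theory Defs
  imports "HOL-Library.Z2" "Jordan_Normal_Form.DL_Submatrix"
begin

text \<open>
  \<^typ>\<open>bit\<close> is the field with two elements, and \<^term>\<open>carrier_vec n :: bit vec set\<close> is the
  space of vectors of length \<open>n\<close> over it, with positions \<open>0, \<dots>, n - 1\<close>. The library does not
  order \<^typ>\<open>bit\<close>; the order \<open>0 < 1\<close> is needed for the entrywise maximum.
\<close>

instantiation bit :: linorder
begin

definition less_eq_bit :: "bit \<Rightarrow> bit \<Rightarrow> bool"
  where "a \<le> b \<longleftrightarrow> a = 0 \<or> b = 1" for a b :: bit

definition less_bit :: "bit \<Rightarrow> bit \<Rightarrow> bool"
  where "a < b \<longleftrightarrow> a = 0 \<and> b = 1" for a b :: bit

instance
proof
  fix a b c :: bit
  show "a < b \<longleftrightarrow> a \<le> b \<and> \<not> b \<le> a"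
    by (cases a; cases b) (simp_all add: less_eq_bit_def less_bit_def)
  show "a \<le> a"
    by (cases a) (simp_all add: less_eq_bit_def)
  show "a \<le> b \<Longrightarrow> b \<le> c \<Longrightarrow> a \<le> c"
    by (cases a; cases b; cases c) (simp_all add: less_eq_bit_def)
  show "a \<le> b \<Longrightarrow> b \<le> a \<Longrightarrow> a = b"
    by (cases a; cases b) (simp_all add: less_eq_bit_def)
  show "a \<le> b \<or> b \<le> a"
    by (cases a; cases b) (simp_all add: less_eq_bit_def)
qed

end

definition powerful :: "nat \<Rightarrow> bit vec set \<Rightarrow> bool" where
  "powerful n S \<longleftrightarrow> S \<subseteq> carrier_vec n \<and>
     (\<forall>X\<subseteq>{..<n}. \<exists>k::nat. card {v \<in> S. \<forall>i\<in>X. v $ i = 0} = 2 ^ k)"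

definition vec_join :: "bit vec \<Rightarrow> bit vec \<Rightarrow> bit vec"  (infixr "\<or>\<^sub>v" 65) where
  "u \<or>\<^sub>v v = vec (dim_vec v) (\<lambda>i. max (u $ i) (v $ i))"

definition permutation_matrix :: "'a::zero_neq_one mat \<Rightarrow> bool" where
  "permutation_matrix P \<longleftrightarrow> square_mat P \<and>
     (\<forall>i<dim_row P. \<forall>j<dim_col P. P $$ (i, j) \<in> {0, 1}) \<and>
     (\<forall>i<dim_row P. \<exists>!j. j < dim_col P \<and> P $$ (i, j) = 1) \<and>
     (\<forall>j<dim_col P. \<exists>!i. i < dim_row P \<and> P $$ (i, j) = 1)"

text \<open>
  The list \<open>rs\<close> enumerates \<open>S\<close> without repetition and thereby fixes an order of the rows; the
  choice of that order does not matter. \<open>J\<close> is the set of chosen columns.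
\<close>

definition permutative :: "nat \<Rightarrow> bit vec set \<Rightarrow> bool" where
  "permutative n S \<longleftrightarrow> S \<subseteq> carrier_vec n \<and>
     (\<exists>rs J. distinct rs \<and> set rs = S \<and> J \<subseteq> {..<n} \<and> card J = card S \<and>
        permutation_matrix (submatrix (mat_of_rows n rs) UNIV J))"

text \<open>
  The empty disjunction is the zero vector. The scalar multiple \<open>a \<cdot>\<^sub>v u\<close> is \<open>u\<close> for \<open>a = 1\<close>
  and the zero vector for \<open>a = 0\<close>.
\<close>

definition disjunctive_closure :: "nat \<Rightarrow> nat \<Rightarrow> (nat \<Rightarrow> bit vec) \<Rightarrow> bit vec set" where
  "disjunctive_closure n m u =
     {foldr (\<or>\<^sub>v) (map (\<lambda>i. a i \<cdot>\<^sub>v u i) [1..<Suc m]) (0\<^sub>v n) | a :: nat \<Rightarrow> bit. True}"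

end

theory Submission
  imports Defs
begin

text \<open>
  Each vector of a permutative set \<open>S\<close> has a private position, at which it alone is nonzero. Hence
  the join of a subset of \<open>S\<close> determines that subset, and the joins correspond to the subsets of \<open>S\<close>.
  A join vanishes on \<open>X\<close> iff all the joined vectors do, so the joins that vanish on \<open>X\<close> correspond
  to the subsets of a fixed subset of \<open>S\<close>.
\<close>

definition has_private_positions :: "nat \<Rightarrow> bit vec set \<Rightarrow> bool" where
  "has_private_positions n S \<longleftrightarrow> (\<forall>v\<in>S. \<exists>c<n. {w \<in> S. w $ c = 1} = {v})"

lemma has_private_positions_subset:
  assumes "has_private_positions n S" and "T \<subseteq> S"
  shows "has_private_positions n T"
  unfolding has_private_positions_def
proof
  fix v assume "v \<in> T"
  then obtain c where "c < n" and "{w \<in> S. w $ c = 1} = {v}"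
    using assms unfolding has_private_positions_def by blast
  then show "\<exists>c<n. {w \<in> T. w $ c = 1} = {v}"
    using \<open>v \<in> T\<close> \<open>T \<subseteq> S\<close> by blast
qed

lemma permutation_matrix_obtain_column:
  assumes "permutation_matrix P" and "i < dim_row P"
  obtains j where "j < dim_col P" and "\<And>k. k < dim_row P \<Longrightarrow> P $$ (k, j) = 1 \<longleftrightarrow> k = i"
  using assms unfolding permutation_matrix_def by metis

lemma pick_less_bound:
  assumes "J \<subseteq> {..<n}" and "j < card J"
  shows "pick J j < n"
  using pick_in_set_le[OF assms(2)] assms(1) by auto

lemma
  assumes "J \<subseteq> {..<n}"
  shows dim_row_submatrix_mat_of_rows: "dim_row (submatrix (mat_of_rows n rs) UNIV J) = length rs"
    and dim_col_submatrix_mat_of_rows: "dim_col (submatrix (mat_of_rows n rs) UNIV J) = card J"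
    and submatrix_mat_of_rows_index: "\<lbrakk>i < length rs; j < card J\<rbrakk>
      \<Longrightarrow> submatrix (mat_of_rows n rs) UNIV J $$ (i, j) = rs ! i $ pick J j"
proof -
  have "{j. j < n \<and> j \<in> J} = J"
    using assms by auto
  then show "dim_row (submatrix (mat_of_rows n rs) UNIV J) = length rs"
    and "dim_col (submatrix (mat_of_rows n rs) UNIV J) = card J"
    and "\<lbrakk>i < length rs; j < card J\<rbrakk>
      \<Longrightarrow> submatrix (mat_of_rows n rs) UNIV J $$ (i, j) = rs ! i $ pick J j"
    by (simp_all add: dim_submatrix submatrix_index pick_UNIV pick_less_bound[OF assms]
        mat_of_rows_index)
qed

lemma permutative_imp_has_private_positions:
  assumes "permutative n S"
  shows "has_private_positions n S"
  unfolding has_private_positions_def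
proof
  fix v assume "v \<in> S"
  obtain rs J where rs: "set rs = S" and J: "J \<subseteq> {..<n}"
    and perm: "permutation_matrix (submatrix (mat_of_rows n rs) UNIV J)"
    using assms unfolding permutative_def by blast
  obtain i where i: "i < length rs" "rs ! i = v"
    using \<open>v \<in> S\<close> rs by (metis in_set_conv_nth)
  then obtain j where j: "j < card J"
    and column: "\<And>k. k < length rs
      \<Longrightarrow> submatrix (mat_of_rows n rs) UNIV J $$ (k, j) = 1 \<longleftrightarrow> k = i"
    using permutation_matrix_obtain_column[OF perm]
    unfolding dim_row_submatrix_mat_of_rows[OF J] dim_col_submatrix_mat_of_rows[OF J] by metis
  have unique: "rs ! k $ pick J j = 1 \<longleftrightarrow> k = i" if "k < length rs" for k
    using column[OF that] by (simp add: submatrix_mat_of_rows_index[OF J that j])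
  have "w $ pick J j = 1 \<longleftrightarrow> w = v" if "w \<in> S" for w
    using that rs i unique by (metis in_set_conv_nth)
  then have "{w \<in> S. w $ pick J j = 1} = {v}"
    using \<open>v \<in> S\<close> by auto
  then show "\<exists>c<n. {w \<in> S. w $ c = 1} = {v}"
    using pick_less_bound[OF J j] by blast
qed

definition vec_Join :: "nat \<Rightarrow> bit vec set \<Rightarrow> bit vec" where
  "vec_Join n U = vec n (\<lambda>i. of_bool (\<exists>v\<in>U. v $ i = 1))"

lemma dim_vec_Join [simp]: "dim_vec (vec_Join n U) = n"
  by (simp add: vec_Join_def)

lemma vec_Join_carrier: "vec_Join n U \<in> carrier_vec n"
  by (simp add: carrier_vecI)

lemma vec_Join_index: "i < n \<Longrightarrow> vec_Join n U $ i = of_bool (\<exists>v\<in>U. v $ i = 1)"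
  by (simp add: vec_Join_def)

lemma max_bit_eq_of_bool: "max a b = of_bool (a = 1 \<or> b = 1)" for a b :: bit
  by (cases a; cases b) (simp_all add: max_def less_eq_bit_def)

lemma vec_Join_empty: "vec_Join n {} = 0\<^sub>v n"
  by (auto simp: vec_Join_index)

lemma vec_join_vec_Join: "v \<or>\<^sub>v vec_Join n U = vec_Join n (insert v U)"
  by (rule eq_vecI) (simp_all add: vec_join_def vec_Join_index max_bit_eq_of_bool)

lemma foldr_vec_join: "foldr (\<or>\<^sub>v) vs (0\<^sub>v n) = vec_Join n (set vs)"
  by (induction vs) (simp_all add: vec_Join_empty vec_join_vec_Join)

lemma vec_Join_image_smult:
  assumes "u ` I \<subseteq> carrier_vec n"
  shows "vec_Join n ((\<lambda>k. a k \<cdot>\<^sub>v u k) ` I) = vec_Join n (u ` {k \<in> I. a k = 1})"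
proof (rule eq_vecI)
  fix i assume "i < dim_vec (vec_Join n (u ` {k \<in> I. a k = 1}))"
  then have "i < n"
    by simp
  then have "(a k \<cdot>\<^sub>v u k) $ i = 1 \<longleftrightarrow> a k = 1 \<and> u k $ i = 1" if "k \<in> I" for k
    using that assms by (cases "a k") auto
  then show "vec_Join n ((\<lambda>k. a k \<cdot>\<^sub>v u k) ` I) $ i = vec_Join n (u ` {k \<in> I. a k = 1}) $ i"
    using \<open>i < n\<close> by (auto simp: vec_Join_index)
qed simp

lemma range_bit_supports_eq_Pow: "range (\<lambda>a :: 'a \<Rightarrow> bit. {k \<in> I. a k = 1}) = Pow I"
proof
  show "Pow I \<subseteq> range (\<lambda>a :: 'a \<Rightarrow> bit. {k \<in> I. a k = 1})"
  proof
    fix A assume "A \<in> Pow I"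
    then have "A = {k \<in> I. of_bool (k \<in> A) = (1 :: bit)}"
      by auto
    then show "A \<in> range (\<lambda>a :: 'a \<Rightarrow> bit. {k \<in> I. a k = 1})"
      by (rule range_eqI[where x = "\<lambda>k. of_bool (k \<in> A)"])
  qed
qed auto

lemma disjunctive_closure_eq_image_Pow:
  assumes "u ` {1..m} \<subseteq> carrier_vec n"
  shows "disjunctive_closure n m u = vec_Join n ` Pow (u ` {1..m})"
proof -
  have "foldr (\<or>\<^sub>v) (map (\<lambda>k. a k \<cdot>\<^sub>v u k) [1..<Suc m]) (0\<^sub>v n)
      = vec_Join n (u ` {k \<in> {1..m}. a k = 1})" for a
    unfolding foldr_vec_join set_map set_upt atLeastLessThanSuc_atLeastAtMost
    by (rule vec_Join_image_smult[OF assms])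
  then have "disjunctive_closure n m u
      = (\<lambda>A. vec_Join n (u ` A)) ` range (\<lambda>a :: nat \<Rightarrow> bit. {k \<in> {1..m}. a k = 1})"
    unfolding disjunctive_closure_def by auto
  also have "\<dots> = vec_Join n ` (image u ` Pow {1..m})"
    by (simp only: range_bit_supports_eq_Pow image_image)
  also have "image u ` Pow {1..m} = Pow (u ` {1..m})"
    by (rule image_Pow_surj[OF refl])
  finally show ?thesis .
qed

lemma inj_on_vec_Join:
  assumes "has_private_positions n S"
  shows "inj_on (vec_Join n) (Pow S)"
proof -
  have "U \<subseteq> V" if "U \<subseteq> S" "V \<subseteq> S" and joins_eq: "vec_Join n U = vec_Join n V" for U V
  proof
    fix v assume "v \<in> U"
    then obtain c where "c < n" and unique: "{w \<in> S. w $ c = 1} = {v}"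
      using assms \<open>U \<subseteq> S\<close> unfolding has_private_positions_def by blast
    have "vec_Join n U $ c = 1"
      using \<open>c < n\<close> \<open>v \<in> U\<close> unique by (auto simp: vec_Join_index)
    then obtain w where "w \<in> V" "w $ c = 1"
      unfolding joins_eq vec_Join_index[OF \<open>c < n\<close>] of_bool_eq_1_iff by blast
    then have "w \<in> {w \<in> S. w $ c = 1}"
      using \<open>V \<subseteq> S\<close> by blast
    then show "v \<in> V"
      using \<open>w \<in> V\<close> unfolding unique by simp
  qed
  then show ?thesis
    by (intro inj_onI subset_antisym) auto
qed

lemma card_vec_Join_image_Pow:
  assumes "has_private_positions n S" and "finite S"
  shows "card (vec_Join n ` Pow S) = 2 ^ card S"
  using assms by (simp add: card_image inj_on_vec_Join card_Pow)

lemma vec_Join_eq_0_on_iff: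
  assumes "X \<subseteq> {..<n}"
  shows "(\<forall>i\<in>X. vec_Join n U $ i = 0) \<longleftrightarrow> U \<subseteq> {v. \<forall>i\<in>X. v $ i = 0}"
proof -
  have "vec_Join n U $ i = 0 \<longleftrightarrow> (\<forall>v\<in>U. v $ i = 0)" if "i \<in> X" for i
    using that assms by (auto simp: vec_Join_index)
  then show ?thesis
    by auto
qed

lemma powerful_vec_Join_image_Pow:
  assumes "has_private_positions n S" and "finite S"
  shows "powerful n (vec_Join n ` Pow S)"
  unfolding powerful_def
proof (intro conjI allI impI)
  show "vec_Join n ` Pow S \<subseteq> carrier_vec n"
    using vec_Join_carrier by blast
next
  fix X assume X: "X \<subseteq> {..<n}"
  define T where "T = {v \<in> S. \<forall>i\<in>X. v $ i = 0}"
  have "T \<subseteq> S"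
    unfolding T_def by blast
  have "{v \<in> vec_Join n ` Pow S. \<forall>i\<in>X. v $ i = 0}
      = vec_Join n ` {U \<in> Pow S. \<forall>i\<in>X. vec_Join n U $ i = 0}"
    by blast
  also have "{U \<in> Pow S. \<forall>i\<in>X. vec_Join n U $ i = 0} = Pow T"
    unfolding vec_Join_eq_0_on_iff[OF X] T_def by blast
  also have "card (vec_Join n ` Pow T) = 2 ^ card T"
    using has_private_positions_subset[OF assms(1) \<open>T \<subseteq> S\<close>] finite_subset[OF \<open>T \<subseteq> S\<close> assms(2)]
    by (rule card_vec_Join_image_Pow)
  finally show "\<exists>k. card {v \<in> vec_Join n ` Pow S. \<forall>i\<in>X. v $ i = 0} = 2 ^ k" ..
qed

theorem theorem8:
  fixes n m :: nat and u :: "nat \<Rightarrow> bit vec" and S :: "bit vec set"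
  assumes "m \<le> n"
    and "S = u ` {1..m}" and "inj_on u {1..m}"
    and "S \<subseteq> carrier_vec n"
    and "permutative n S"
  shows "powerful n (disjunctive_closure n m u) \<and>
         card (disjunctive_closure n m u) = 2 ^ m"
proof -
  have "disjunctive_closure n m u = vec_Join n ` Pow S"
    using assms(2,4) disjunctive_closure_eq_image_Pow by simp
  moreover have "has_private_positions n S"
    using assms(5) by (rule permutative_imp_has_private_positions)
  moreover have "finite S" and "card S = m"
    using assms(2,3) by (simp_all add: card_image)
  ultimately show ?thesis
    using powerful_vec_Join_image_Pow card_vec_Join_image_Pow by simp
qed

end
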